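(* Let $N\ge2$ be an integer and let $g_1,\dots,g_N\in W_0$ satisfy the mutual independence condition. (i) If every $g_j$ is odd, then for every choice of points $0<x_1<\dots<x_{N-1}<\tfrac12$ there is a non-trivial (i.e. not identically zero) function $g\in\operatorname{Span}(g_1,\dots,g_N)$ such that the set $A_N=\left(\{\pm x_1,\dots,\pm x_{N-1}\}\cup\{0,\tfrac12\}\right)+\mathbb{Z}$ is not a uniqueness set for $V^\infty(g)$. (ii) If every $g_j$ is even, then for every choice of points $0<x_1<\dots<x_{N-1}<\tfrac12$ there is a non-trivial function $g\in\operatorname{Span}(g_1,\dots,g_N)$ such that the set $B_N=\left(\{\pm x_1,\dots,\pm x_{N-1}\}\cup\{\tfrac12\}\right)+\mathbb{Z}$ is not a uniqueness set for $V^\infty(g)$.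
   Context: $W_0$ is the set of continuous functions $g:\mathbb{R}\to\mathbb{C}$ with $\sum_{m\in\mathbb{Z}}\|g\|_{L^\infty(m,m+1)}<\infty$. For $g\in W_0$, $V^\infty(g)=\{\sum_{n\in\mathbb{Z}}c_n g(x-n):\{c_n\}\in\ell^\infty(\mathbb{Z})\}$, and for $g_1,\dots,g_N\in W_0$, $$V^\infty(g_1,\dots,g_N)=\Big\{f(x)=\sum_{j=1}^N\sum_{n\in\mathbb{Z}}c_{j,n}g_j(x-n):\ \{c_{j,n}\}_{n\in\mathbb{Z}}\in\ell^\infty(\mathbb{Z}),\ 1\le j\le N\Big\}.$$ A function $g\in W_0$ satisfies the stability condition if for every $p\in[1,\infty]$ there are constants $A,B>0$ such that $A\|\{c_n\}\|_{\ell^p}\le\|\sum_n c_n g(\cdot-n)\|_{L^p(\mathbb{R})}\le B\|\{c_n\}\|_{\ell^p}$ for all $\{c_n\}\in\ell^p(\mathbb{Z})$. The functions $g_1,\dots,g_N\in W_0$ satisfy the mutual independence condition if each $g_j$ satisfies the stability condition and every $f\in V^\infty(g_1,\dots,g_N)$ admits a unique decomposition $f=\sum_{j=1}^N f_j$ with $f_j\in V^\infty(g_j)$. $\operatorname{Span}$ denotes the complex linear span. A set $\Lambda\subset\mathbb{R}$ is a uniqueness set for $V^\infty(g)$ if every $f\in V^\infty(g)$ vanishing at all points of $\Lambda$ is identically zero. $g$ is odd if $g(-x)=-g(x)$ and even if $g(-x)=g(x)$ for all $x\in\mathbb{R}$. *)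

theory Defs
  imports
    "HOL-Analysis.Analysis"
    "HOL-Probability.Essential_Supremum"
    "HOL-Library.Function_Algebras"
begin

text \<open>
  \<open>Lp_norm p M f\<close> is the \<open>L\<^sup>p(M)\<close> norm as an extended number, for \<open>1 \<le> p \<le> \<infinity>\<close>; it is
  \<open>\<infinity>\<close> when the integral diverges. With \<open>M\<close> the counting measure on the integers
  it is the \<open>\<ell>\<^sup>p(\<int>)\<close> norm.
\<close>

definition Lp_norm :: "ennreal \<Rightarrow> 'a measure \<Rightarrow> ('a \<Rightarrow> complex) \<Rightarrow> ennreal" where
  "Lp_norm p M f =
     (if p = \<infinity> then esssup M (\<lambda>x. ennreal (norm (f x)))
      else let I = (\<integral>\<^sup>+ x. ennreal (norm (f x) powr enn2real p) \<partial>M)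
           in if I = \<infinity> then \<infinity> else ennreal (enn2real I powr (1 / enn2real p)))"

abbreviation ell_norm :: "ennreal \<Rightarrow> (int \<Rightarrow> complex) \<Rightarrow> ennreal" where
  "ell_norm p c \<equiv> Lp_norm p (count_space UNIV) c"

definition ell :: "ennreal \<Rightarrow> (int \<Rightarrow> complex) set" where
  "ell p = {c. ell_norm p c < \<infinity>}"

definition W0 :: "(real \<Rightarrow> complex) set" where
  "W0 = {g. continuous_on UNIV g \<and>
            (\<Sum>\<^sub>\<infinity>m\<in>(UNIV :: int set).
               Lp_norm \<infinity> (restrict_space lborel {of_int m <..< of_int m + 1}) g) < \<infinity>}"

text \<open>
  For \<open>g \<in> W0\<close> and bounded \<open>c\<close> the series converges absolutely at every point, so the value
  that \<open>infsum\<close> assigns to non-summable families plays no role.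
\<close>

definition shift_series :: "(real \<Rightarrow> complex) \<Rightarrow> (int \<Rightarrow> complex) \<Rightarrow> real \<Rightarrow> complex" where
  "shift_series g c = (\<lambda>x. \<Sum>\<^sub>\<infinity>n\<in>UNIV. c n * g (x - of_int n))"

definition Vinf :: "(real \<Rightarrow> complex) \<Rightarrow> (real \<Rightarrow> complex) set" where
  "Vinf g = {shift_series g c | c. c \<in> ell \<infinity>}"

definition Vinf_fam :: "nat \<Rightarrow> (nat \<Rightarrow> real \<Rightarrow> complex) \<Rightarrow> (real \<Rightarrow> complex) set" where
  "Vinf_fam N g =
     {(\<lambda>x. \<Sum>j=1..N. shift_series (g j) (c j) x) | c. \<forall>j\<in>{1..N}. c j \<in> ell \<infinity>}"

definition stable :: "(real \<Rightarrow> complex) \<Rightarrow> bool" where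
  "stable g \<longleftrightarrow>
     (\<forall>p\<ge>1. \<exists>A B :: real. A > 0 \<and> B > 0 \<and>
        (\<forall>c\<in>ell p.
           ennreal A * ell_norm p c \<le> Lp_norm p lborel (shift_series g c) \<and>
           Lp_norm p lborel (shift_series g c) \<le> ennreal B * ell_norm p c))"

text \<open>
  Decompositions are extensional families (\<open>PiE\<close>), so that uniqueness concerns only the
  components with index in \<open>{1..N}\<close>.
\<close>

definition mutually_independent :: "nat \<Rightarrow> (nat \<Rightarrow> real \<Rightarrow> complex) \<Rightarrow> bool" where
  "mutually_independent N g \<longleftrightarrow>
     (\<forall>j\<in>{1..N}. stable (g j)) \<and>
     (\<forall>f\<in>Vinf_fam N g. \<exists>!F. F \<in> (\<Pi>\<^sub>E j\<in>{1..N}. Vinf (g j)) \<and> f = (\<lambda>x. \<Sum>j=1..N. F j x))"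

definition uniqueness_set :: "real set \<Rightarrow> (real \<Rightarrow> complex) set \<Rightarrow> bool" where
  "uniqueness_set \<Lambda> V \<longleftrightarrow> (\<forall>f\<in>V. (\<forall>x\<in>\<Lambda>. f x = 0) \<longrightarrow> (\<forall>x. f x = 0))"

definition plus_ints :: "real set \<Rightarrow> real set" where
  "plus_ints S = {s + of_int k | (s :: real) (k :: int). s \<in> S}"

definition odd_fun :: "(real \<Rightarrow> complex) \<Rightarrow> bool" where
  "odd_fun g \<longleftrightarrow> (\<forall>x. g (- x) = - g x)"

definition even_fun :: "(real \<Rightarrow> complex) \<Rightarrow> bool" where
  "even_fun g \<longleftrightarrow> (\<forall>x. g (- x) = g x)"

definition cfun_scale :: "complex \<Rightarrow> (real \<Rightarrow> complex) \<Rightarrow> real \<Rightarrow> complex" where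
  "cfun_scale a f = (\<lambda>x. a * f x)"

global_interpretation cfun: vector_space cfun_scale
  by unfold_locales (auto simp: cfun_scale_def fun_eq_iff algebra_simps)

end

theory Submission
  imports Defs
begin

text \<open>
  The counterexample is a twisted periodization. For a sign \<open>e \<in> {1, -1}\<close>, the series of \<open>g\<close> with
  coefficients \<open>e\<^sup>n\<close> satisfies \<open>f (x + k) = e\<^sup>k f x\<close> for integers \<open>k\<close>, and it inherits the parity of
  \<open>g\<close>. Pair odd functions with \<open>e = 1\<close> and even ones with \<open>e = -1\<close>. In both cases \<open>f (-x) = -e f x\<close>,
  so \<open>f (1/2) = e f (-1/2) = - f (1/2)\<close>, and \<open>f\<close> vanishes at \<open>1/2\<close> for free. An odd \<open>f\<close> also
  vanishes at \<open>0\<close>.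

  Let \<open>f\<^sub>j\<close> be the periodization of \<open>g\<^sub>j\<close>. A combination \<open>f = \<Sum>\<^sub>j a\<^sub>j f\<^sub>j\<close> has \<open>N\<close> free coefficients, and
  vanishing at \<open>x\<^sub>1, \<dots>, x\<^bsub>N-1\<^esub>\<close> imposes only \<open>N - 1\<close> linear equations, so some \<open>a \<noteq> 0\<close> works
  (\<open>homogeneous_system_nontrivial_solution\<close>). Parity and quasi-periodicity propagate the zeros to the
  whole set. Since all \<open>f\<^sub>j\<close> use the same coefficient sequence, \<open>f\<close> is itself the periodization of
  \<open>\<Sum>\<^sub>j a\<^sub>j g\<^sub>j\<close>, and hence lies in the shift-invariant space of this single generator. Finally \<open>f\<close> is
  not the zero function, because mutual independence makes the map from coefficient sequences to
  functions injective (\<open>mutually_independent_coefficients_zero\<close>).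
\<close>

section \<open>Pointwise convergence of shift series\<close>

text \<open>
  Lebesgue measure charges every nonempty open set, so if \<open>\<bar>g\<bar>\<close> exceeded the
  essential supremum at one point, possibly an endpoint, the excess would spread by continuity to a subset of positive measure.
\<close>

lemma norm_le_esssup_unit_interval:
  fixes g :: "real \<Rightarrow> complex" and m :: int
  assumes cont: "continuous_on UNIV g" and y: "y \<in> {of_int m..of_int m + 1}"
  shows "ennreal (norm (g y)) \<le> Lp_norm \<infinity> (restrict_space lborel {of_int m<..<of_int m + 1}) g"
proof (rule ccontr)
  define I where "I = {of_int m<..<of_int m + 1 :: real}"
  define S where "S = Lp_norm \<infinity> (restrict_space lborel I) g"
  assume "\<not> ?thesis"
  then have less: "S < ennreal (norm (g y))"
    unfolding S_def I_def by simp
  then obtain s where s: "S = ennreal s" "0 \<le> s"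
    by (cases S) auto
  with less have "s < norm (g y)"
    by (metis ennreal_le_iff linorder_not_le)
  define U where "U = {z. s < norm (g z)}"
  have "open U"
    unfolding U_def using cont by (intro open_Collect_less continuous_intros) auto
  have "y \<in> U"
    using \<open>s < norm (g y)\<close> by (simp add: U_def)
  have "y \<in> closure I"
    using y unfolding I_def by (subst closure_greaterThanLessThan) auto
  then have nonempty: "U \<inter> I \<noteq> {}"
    using \<open>open U\<close> \<open>y \<in> U\<close> by (metis IntI emptyE open_Int_closure_eq_empty)
  have "AE z in restrict_space lborel I. ennreal (norm (g z)) \<le> S"
    using esssup_AE[of "\<lambda>z. ennreal (norm (g z))" "restrict_space lborel I"]
    unfolding S_def Lp_norm_def by simp
  then have "AE z in lborel. z \<in> I \<longrightarrow> ennreal (norm (g z)) \<le> S"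
    by (subst (asm) AE_restrict_space_iff) (auto simp: I_def)
  then have "AE z in lborel. z \<notin> U \<inter> I"
    by eventually_elim (use s in \<open>auto simp: U_def\<close>)
  then have "emeasure lborel (U \<inter> I) = 0"
    using \<open>open U\<close> by (subst (asm) AE_iff_measurable[where N = "U \<inter> I"]) (auto simp: I_def)
  then have "U \<inter> I \<in> null_sets lebesgue"
    using \<open>open U\<close> by (intro null_sets_completionI) (auto simp: null_sets_def I_def)
  then have "negligible (U \<inter> I)"
    by (simp add: negligible_iff_null_sets)
  moreover have "open (U \<inter> I)"
    using \<open>open U\<close> by (auto simp: I_def)
  ultimately show False
    using nonempty open_not_negligible by blast
qed

text \<open>
  For fixed \<open>x\<close>, the point \<open>x - n\<close> lies in the closed unit interval with left endpoint \<open>\<lfloor>x\<rfloor> - n\<close>.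
  These intervals are distinct for distinct \<open>n\<close>, so the sum of the local suprema dominates the series.
\<close>

lemma shift_series_summable:
  assumes g: "g \<in> W0" and c: "\<And>n. norm (c n) \<le> C"
  shows "(\<lambda>n. c n * g (x - of_int n)) summable_on UNIV"
proof -
  define S where
    "S m = Lp_norm \<infinity> (restrict_space lborel {of_int m<..<of_int m + 1}) g" for m :: int
  define T where "T = (\<Sum>\<^sub>\<infinity>m. S m)"
  have cont: "continuous_on UNIV g" and "T < \<infinity>"
    using g by (auto simp: W0_def T_def S_def)
  have "(\<lambda>n. norm (g (x - of_int n))) summable_on UNIV"
  proof (rule nonneg_bdd_above_summable_on)
    show "bdd_above (sum (\<lambda>n. norm (g (x - of_int n))) ` {F. F \<subseteq> UNIV \<and> finite F})"
    proof (rule bdd_aboveI2)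
      fix F :: "int set"
      assume "F \<in> {F. F \<subseteq> UNIV \<and> finite F}"
      then have "finite F" by simp
      have "ennreal (\<Sum>n\<in>F. norm (g (x - of_int n))) = (\<Sum>n\<in>F. ennreal (norm (g (x - of_int n))))"
        by simp
      also have "\<dots> \<le> (\<Sum>n\<in>F. S (\<lfloor>x\<rfloor> - n))"
        unfolding S_def
      proof (intro sum_mono norm_le_esssup_unit_interval cont)
        fix n
        show "x - of_int n \<in> {of_int (\<lfloor>x\<rfloor> - n)..of_int (\<lfloor>x\<rfloor> - n) + 1}"
          using floor_correct[of x] by simp
      qed
      also have "\<dots> = sum S ((\<lambda>n. \<lfloor>x\<rfloor> - n) ` F)"
        by (subst sum.reindex) (auto simp: inj_on_def)
      also have "\<dots> = infsum S ((\<lambda>n. \<lfloor>x\<rfloor> - n) ` F)"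
        using \<open>finite F\<close> by simp
      also have "\<dots> \<le> T"
        unfolding T_def by (rule infsum_mono_neutral) (auto intro: nonneg_summable_on_complete)
      finally show "(\<Sum>n\<in>F. norm (g (x - of_int n))) \<le> enn2real T"
        using \<open>T < \<infinity>\<close> by (subst ennreal_le_iff[symmetric]) auto
    qed
  qed simp
  then have *: "(\<lambda>n. C * norm (g (x - of_int n))) summable_on UNIV"
    by (rule summable_on_cmult_right)
  have "(\<lambda>n. norm (c n * g (x - of_int n))) summable_on UNIV"
    by (rule Infinite_Sum.abs_summable_on_comparison_test'[OF *])
       (auto simp: norm_mult intro!: mult_right_mono c)
  then show ?thesis
    by (rule abs_summable_summable)
qed

lemma shift_series_cmult: "shift_series g (\<lambda>n. a * c n) x = a * shift_series g c x"
  unfolding shift_series_def by (simp add: mult.assoc infsum_cmult_right')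

lemma has_sum_finite_sum:
  fixes f :: "'j \<Rightarrow> 'i \<Rightarrow> 'a::topological_comm_monoid_add"
  assumes "\<And>j. j \<in> J \<Longrightarrow> (f j has_sum s j) A"
  shows "((\<lambda>i. \<Sum>j\<in>J. f j i) has_sum (\<Sum>j\<in>J. s j)) A"
  using assms by (induction J rule: infinite_finite_induct) (simp_all add: has_sum_add)

lemma shift_series_linear_combination:
  assumes g: "\<And>j. j \<in> J \<Longrightarrow> g j \<in> W0" and c: "\<And>n. norm (c n) \<le> C"
  shows "shift_series (\<lambda>y. \<Sum>j\<in>J. a j * g j y) c x = (\<Sum>j\<in>J. a j * shift_series (g j) c x)"
proof -
  have "((\<lambda>n. \<Sum>j\<in>J. a j * (c n * g j (x - of_int n)))
      has_sum (\<Sum>j\<in>J. a j * shift_series (g j) c x)) UNIV"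
    unfolding shift_series_def
    by (intro has_sum_finite_sum has_sum_cmult_right has_sum_infsum shift_series_summable[OF g c])
  then show ?thesis
    by (simp add: shift_series_def infsumI sum_distrib_left mult.left_commute)
qed

section \<open>Injectivity of the synthesis map\<close>

lemma bounded_in_ell_infinity:
  assumes "\<And>n. norm (c n) \<le> C"
  shows "c \<in> ell \<infinity>"
proof -
  have "esssup (count_space UNIV) (\<lambda>n. ennreal (norm (c n))) \<le> ennreal C"
    by (rule esssup_I) (auto simp: AE_count_space intro: ennreal_leI assms)
  then show ?thesis
    unfolding ell_def Lp_norm_def by (auto simp: le_less_trans)
qed

lemma stable_coefficients_zero:
  assumes "stable g" and c: "c \<in> ell \<infinity>" and zero: "shift_series g c = (\<lambda>_. 0)"
  shows "c n = 0"
proof -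
  obtain A :: real where "A > 0" and
    "ennreal A * ell_norm \<infinity> c \<le> Lp_norm \<infinity> lborel (shift_series g c)"
    using \<open>stable g\<close> c unfolding stable_def by (metis top_greatest infinity_ennreal_def)
  moreover have "Lp_norm \<infinity> lborel (shift_series g c) \<le> 0"
    unfolding zero Lp_norm_def by (simp add: esssup_const)
  ultimately have "ell_norm \<infinity> c = 0"
    by auto
  moreover have "AE n in count_space UNIV. ennreal (norm (c n)) \<le> ell_norm \<infinity> c"
    using esssup_AE[of "\<lambda>n. ennreal (norm (c n))" "count_space UNIV"]
    by (simp add: Lp_norm_def)
  ultimately show ?thesis
    by (simp add: AE_count_space)
qed

text \<open>
  The zero function also decomposes into zero summands. Uniqueness therefore annihilates every
  summand separately, and stability with \<open>p = \<infinity>\<close> annihilates its coefficients.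
\<close>

lemma mutually_independent_coefficients_zero:
  assumes indep: "mutually_independent N g"
    and c: "\<And>j. j \<in> {1..N} \<Longrightarrow> c j \<in> ell \<infinity>"
    and zero: "\<And>x. (\<Sum>j=1..N. shift_series (g j) (c j) x) = 0"
    and j: "j \<in> {1..N}"
  shows "c j n = 0"
proof -
  define F where "F = restrict (\<lambda>j. shift_series (g j) (c j)) {1..N}"
  define Z where "Z = restrict (\<lambda>j. shift_series (g j) (\<lambda>_. 0)) {1..N}"
  have Z0: "shift_series (g j) (\<lambda>_. 0) = (\<lambda>_. 0)" for j
    by (simp add: shift_series_def)
  have z: "(\<lambda>_. 0) \<in> ell \<infinity>"
    by (rule bounded_in_ell_infinity[of _ 0]) simp
  have fam: "(\<lambda>_. 0) \<in> Vinf_fam N g"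
    unfolding Vinf_fam_def using c zero by (auto intro!: exI[of _ c])
  have F: "F \<in> (\<Pi>\<^sub>E j\<in>{1..N}. Vinf (g j)) \<and> (\<lambda>_. 0) = (\<lambda>x. \<Sum>j=1..N. F j x)"
    using c zero by (auto simp: F_def Vinf_def)
  have Z: "Z \<in> (\<Pi>\<^sub>E j\<in>{1..N}. Vinf (g j)) \<and> (\<lambda>_. 0) = (\<lambda>x. \<Sum>j=1..N. Z j x)"
    using z by (auto simp: Z_def Vinf_def Z0 intro!: exI[of _ "\<lambda>_. 0"])
  have "F = Z"
    using indep fam F Z unfolding mutually_independent_def by blast
  then have "F j = Z j"
    by simp
  then have "shift_series (g j) (c j) = (\<lambda>_. 0)"
    using j by (simp add: F_def Z_def Z0)
  moreover have "stable (g j)"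
    using indep j by (simp add: mutually_independent_def)
  ultimately show ?thesis
    using stable_coefficients_zero c[OF j] by blast
qed

section \<open>Underdetermined homogeneous systems\<close>

text \<open>Gaussian elimination: each step uses one equation to eliminate one unknown.\<close>

lemma homogeneous_system_nontrivial_solution:
  fixes v :: "'j \<Rightarrow> 'i \<Rightarrow> 'k::field"
  assumes "finite I" "finite J" "card I < card J"
  shows "\<exists>a. (\<exists>j\<in>J. a j \<noteq> 0) \<and> (\<forall>i\<in>I. (\<Sum>j\<in>J. a j * v j i) = 0)"
  using assms
proof (induction I arbitrary: J v rule: finite_induct)
  case empty
  then obtain j where "j \<in> J"
    by fastforce
  then show ?case
    by (intro exI[of _ "\<lambda>_. 1"]) auto
next
  case (insert i I)
  show ?case
  proof (cases "\<forall>j\<in>J. v j i = 0")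
    case True
    then show ?thesis
      using insert.IH[of J v] insert.prems insert.hyps by auto
  next
    case False
    then obtain k where k: "k \<in> J" "v k i \<noteq> 0"
      by blast
    define w where "w j l = v j l - v j i / v k i * v k l" for j l
    have "card I < card (J - {k})"
      using insert.prems insert.hyps k by simp
    then obtain b where b: "\<exists>j\<in>J - {k}. b j \<noteq> 0" "\<forall>l\<in>I. (\<Sum>j\<in>J - {k}. b j * w j l) = 0"
      using insert.IH[of "J - {k}" w] insert.prems by auto
    \<comment> \<open>The value at the pivot \<open>k\<close> is the one that equation \<open>i\<close> forces.\<close>
    define t where "t = - (\<Sum>j\<in>J - {k}. b j * (v j i / v k i))"
    define a where "a = b(k := t)"
    have split: "(\<Sum>j\<in>J. a j * v j l) = (\<Sum>j\<in>J - {k}. b j * w j l)" for l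
    proof -
      have "(\<Sum>j\<in>J. a j * v j l) = a k * v k l + (\<Sum>j\<in>J - {k}. a j * v j l)"
        using k insert.prems by (simp add: sum.remove)
      also have "(\<Sum>j\<in>J - {k}. a j * v j l) = (\<Sum>j\<in>J - {k}. b j * v j l)"
        by (intro sum.cong) (auto simp: a_def)
      also have "a k * v k l + \<dots> = (\<Sum>j\<in>J - {k}. b j * w j l)"
        by (simp add: a_def t_def w_def algebra_simps sum_subtractf sum_distrib_left sum_distrib_right)
      finally show ?thesis .
    qed
    have "w j i = 0" for j
      using k by (simp add: w_def)
    then have "\<forall>l\<in>insert i I. (\<Sum>j\<in>J. a j * v j l) = 0"
      using b(2) by (auto simp: split)
    moreover have "\<exists>j\<in>J. a j \<noteq> 0"
      using b(1) by (auto simp: a_def)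
    ultimately show ?thesis
      by blast
  qed
qed

section \<open>Twisted periodizations\<close>

lemma periodization_shift:
  fixes e :: complex and k :: int
  assumes "e \<noteq> 0"
  shows "shift_series g (power_int e) (x + of_int k) = e powi k * shift_series g (power_int e) x"
proof -
  have "shift_series g (power_int e) (x + of_int k)
      = (\<Sum>\<^sub>\<infinity>n. e powi (n + k) * g (x + of_int k - of_int (n + k)))"
    unfolding shift_series_def
    by (rule infsum_reindex_bij_betw[symmetric])
       (rule bij_betw_byWitness[where f' = "\<lambda>n. n - k"], auto)
  also have "\<dots> = (\<Sum>\<^sub>\<infinity>n. e powi k * (e powi n * g (x - of_int n)))"
    using assms by (simp add: power_int_add mult_ac)
  also have "\<dots> = e powi k * shift_series g (power_int e) x"
    unfolding shift_series_def by (rule infsum_cmult_right')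
  finally show ?thesis .
qed

text \<open>
  Reflection replaces the coefficient \<open>e\<^sup>n\<close> by \<open>e\<^sup>-\<^sup>n\<close>, which is the same number for a sign \<open>e\<close>.
\<close>

lemma periodization_parity:
  fixes e s :: complex
  assumes e: "e * e = 1" and g: "\<And>x. g (- x) = s * g x"
  shows "shift_series g (power_int e) (- x) = s * shift_series g (power_int e) x"
proof -
  have inv: "inverse e = e"
    using e by (rule inverse_unique)
  have "shift_series g (power_int e) (- x)
      = (\<Sum>\<^sub>\<infinity>n. e powi (- n) * g (- x - of_int (- n)))"
    unfolding shift_series_def
    by (rule infsum_reindex_bij_betw[symmetric])
       (rule bij_betw_byWitness[where f' = uminus], auto)
  also have "\<dots> = (\<Sum>\<^sub>\<infinity>n. s * (e powi n * g (x - of_int n)))"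
  proof (rule infsum_cong)
    fix n :: int
    have "e powi (- n) = e powi n"
      using inv by (metis power_int_inverse power_int_minus)
    moreover have "g (- x - of_int (- n)) = s * g (x - of_int n)"
      using g[of "x - of_int n"] by simp
    ultimately show "e powi (- n) * g (- x - of_int (- n)) = s * (e powi n * g (x - of_int n))"
      by simp
  qed
  also have "\<dots> = s * shift_series g (power_int e) x"
    unfolding shift_series_def by (rule infsum_cmult_right')
  finally show ?thesis .
qed

text \<open>
  The parity factor \<open>-e\<close> is opposite to the factor \<open>e\<close> of translation by \<open>1\<close>. This opposition forces
  the zero at \<open>1/2\<close>, while the points of \<open>P\<close> are handled by the choice of the coefficients.
\<close>

lemma vanishing_periodization_exists:
  fixes e :: complex and P :: "real set"
  assumes W: "\<And>j. j \<in> {1..N} \<Longrightarrow> g j \<in> W0" and indep: "mutually_independent N g"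
    and e: "e * e = 1" and parity: "\<And>j x. j \<in> {1..N} \<Longrightarrow> g j (- x) = - e * g j x"
    and P: "finite P" "card P < N"
  obtains h f where "h \<in> cfun.span (g ` {1..N})" "h \<noteq> (\<lambda>_. 0)"
    "f \<in> Vinf h" "f \<noteq> (\<lambda>_. 0)" "\<And>x. f (- x) = - e * f x"
    "\<And>x. x \<in> plus_ints (P \<union> uminus ` P \<union> {1/2}) \<Longrightarrow> f x = 0"
    "\<And>x k. f (x + of_int k) = e powi k * f x"
proof -
  have e0: "e \<noteq> 0"
    using e by auto
  have "norm e * norm e = 1"
    using e by (metis norm_mult norm_one)
  then have "norm e = 1"
    using norm_ge_zero[of e] by (simp add: square_eq_1_iff)
  then have norm_powi: "norm (e powi n) = 1" for n
    by (simp add: norm_power_int)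
  obtain a where a: "\<exists>j\<in>{1..N}. a j \<noteq> 0"
    and sol: "\<forall>x\<in>P. (\<Sum>j=1..N. a j * shift_series (g j) (power_int e) x) = 0"
    using homogeneous_system_nontrivial_solution
      [of P "{1..N}" "\<lambda>j. shift_series (g j) (power_int e)"] P by auto
  define h where "h = (\<lambda>y. \<Sum>j=1..N. a j * g j y)"
  define f where "f = shift_series h (power_int e)"
  have f_eq: "f x = (\<Sum>j=1..N. a j * shift_series (g j) (power_int e) x)" for x
    unfolding f_def h_def by (rule shift_series_linear_combination[where C = 1]) (auto simp: W norm_powi)
  have shift: "f (x + of_int k) = e powi k * f x" for x k
    unfolding f_def by (rule periodization_shift[OF e0])
  have "h (- x) = - e * h x" for x
    by (simp add: h_def parity sum_distrib_left sum_negf mult_ac)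
  then have refl: "f (- x) = - e * f x" for x
    unfolding f_def by (rule periodization_parity[OF e])
  have nonzero: "f \<noteq> (\<lambda>_. 0)"
  proof
    assume "f = (\<lambda>_. 0)"
    then have zero: "(\<Sum>j=1..N. shift_series (g j) (\<lambda>n. a j * e powi n) x) = 0" for x
      using f_eq[of x] by (simp add: shift_series_cmult)
    have "(\<lambda>n. a j * e powi n) \<in> ell \<infinity>" for j
      by (rule bounded_in_ell_infinity[of _ "norm (a j)"]) (simp add: norm_mult norm_powi)
    then have "a j * e powi 0 = 0" if "j \<in> {1..N}" for j
      using mutually_independent_coefficients_zero
        [OF indep, of "\<lambda>j n. a j * e powi n", OF _ zero that] by blast
    with a show False
      by auto
  qed
  have h_sum: "h = (\<Sum>j=1..N. cfun_scale (a j) (g j))"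
  proof
    fix y
    have "(\<Sum>j\<in>J. cfun_scale (a j) (g j)) y = (\<Sum>j\<in>J. a j * g j y)" if "finite J" for J
      using that by induction (auto simp: cfun_scale_def)
    then show "h y = (\<Sum>j=1..N. cfun_scale (a j) (g j)) y"
      by (simp add: h_def)
  qed
  have span: "h \<in> cfun.span (g ` {1..N})"
    unfolding h_sum by (intro cfun.span_sum cfun.span_scale cfun.span_base imageI)
  have "h \<noteq> (\<lambda>_. 0)"
    using nonzero by (auto simp: f_def shift_series_def)
  have "f \<in> Vinf h"
    unfolding Vinf_def f_def using bounded_in_ell_infinity[of "power_int e" 1] norm_powi by auto
  have half: "f (1/2) = 0"
  proof -
    have "f (1/2) = e * f (- (1/2))"
      using shift[of "- (1/2)" 1] by simp
    also have "\<dots> = - (e * e) * f (1/2)"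
      by (simp add: refl[of "1/2"])
    finally show ?thesis
      using e by simp
  qed
  have "f x = 0" if mem: "x \<in> plus_ints (P \<union> uminus ` P \<union> {1/2})" for x
  proof -
    obtain s k where x: "x = s + of_int k" and s: "s \<in> P \<union> uminus ` P \<union> {1/2}"
      using mem unfolding plus_ints_def by blast
    have P0: "f p = 0" if "p \<in> P" for p
      using that sol by (simp add: f_eq)
    consider "s \<in> P" | p where "p \<in> P" "s = - p" | "s = 1/2"
      using s by blast
    then have "f s = 0"
      by cases (simp_all only: P0 refl half mult_zero_right)
    then show ?thesis
      by (simp add: x shift)
  qed
  with that span \<open>h \<noteq> _\<close> \<open>f \<in> Vinf h\<close> nonzero refl shift show thesis
    by blast
qed

theorem corollary3p6:
  fixes N :: nat and g :: "nat \<Rightarrow> real \<Rightarrow> complex"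
  assumes "N \<ge> 2"
    and "\<forall>j\<in>{1..N}. g j \<in> W0"
    and "mutually_independent N g"
  shows
    "((\<forall>j\<in>{1..N}. odd_fun (g j)) \<longrightarrow>
      (\<forall>x :: nat \<Rightarrow> real.
         0 < x 1 \<and> strict_mono_on {1..N-1} x \<and> x (N-1) < 1/2 \<longrightarrow>
         (\<exists>h \<in> cfun.span (g ` {1..N}). h \<noteq> (\<lambda>_. 0) \<and>
            \<not> uniqueness_set
               (plus_ints (x ` {1..N-1} \<union> (\<lambda>i. - x i) ` {1..N-1} \<union> {0, 1/2})) (Vinf h))))
     \<and>
     ((\<forall>j\<in>{1..N}. even_fun (g j)) \<longrightarrow>
      (\<forall>x :: nat \<Rightarrow> real.
         0 < x 1 \<and> strict_mono_on {1..N-1} x \<and> x (N-1) < 1/2 \<longrightarrow>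
         (\<exists>h \<in> cfun.span (g ` {1..N}). h \<noteq> (\<lambda>_. 0) \<and>
            \<not> uniqueness_set
               (plus_ints (x ` {1..N-1} \<union> (\<lambda>i. - x i) ` {1..N-1} \<union> {1/2})) (Vinf h))))"
proof (intro conjI impI allI)
  fix x :: "nat \<Rightarrow> real"
  have card: "card (x ` {1..N-1}) < N"
    using card_image_le[of "{1..N-1}" x] \<open>N \<ge> 2\<close> by simp
  have W: "g j \<in> W0" if "j \<in> {1..N}" for j
    using assms(2) that by blast
  {
    assume odd: "\<forall>j\<in>{1..N}. odd_fun (g j)"
    obtain h f where h: "h \<in> cfun.span (g ` {1..N})" "h \<noteq> (\<lambda>_. 0)"
      and f: "f \<in> Vinf h" "f \<noteq> (\<lambda>_. 0)" and refl: "\<And>y. f (- y) = - 1 * f y"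
      and zero: "\<And>y. y \<in> plus_ints (x ` {1..N-1} \<union> uminus ` x ` {1..N-1} \<union> {1/2}) \<Longrightarrow> f y = 0"
      and shift: "\<And>y k. f (y + of_int k) = 1 powi k * f y"
      by (rule vanishing_periodization_exists[OF W assms(3), of 1 "x ` {1..N-1}"])
         (use odd card in \<open>auto simp: odd_fun_def\<close>)
    have "f 0 = 0"
      using refl[of 0] by simp
    then have integers: "f (of_int k) = 0" for k
      using shift[of 0 k] by simp
    have "f y = 0"
      if "y \<in> plus_ints (x ` {1..N-1} \<union> (\<lambda>i. - x i) ` {1..N-1} \<union> {0, 1/2})" for y
      using that zero[of y] integers by (auto simp: plus_ints_def image_image)
    with h f show "\<exists>h \<in> cfun.span (g ` {1..N}). h \<noteq> (\<lambda>_. 0) \<and>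
        \<not> uniqueness_set
           (plus_ints (x ` {1..N-1} \<union> (\<lambda>i. - x i) ` {1..N-1} \<union> {0, 1/2})) (Vinf h)"
      unfolding uniqueness_set_def by blast
  next
    assume even: "\<forall>j\<in>{1..N}. even_fun (g j)"
    obtain h f where "h \<in> cfun.span (g ` {1..N})" "h \<noteq> (\<lambda>_. 0)" "f \<in> Vinf h" "f \<noteq> (\<lambda>_. 0)"
      and zero: "\<And>y. y \<in> plus_ints (x ` {1..N-1} \<union> uminus ` x ` {1..N-1} \<union> {1/2}) \<Longrightarrow> f y = 0"
      by (rule vanishing_periodization_exists[OF W assms(3), of "-1" "x ` {1..N-1}"])
         (use even card in \<open>auto simp: even_fun_def\<close>)
    then show "\<exists>h \<in> cfun.span (g ` {1..N}). h \<noteq> (\<lambda>_. 0) \<and>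
        \<not> uniqueness_set
           (plus_ints (x ` {1..N-1} \<union> (\<lambda>i. - x i) ` {1..N-1} \<union> {1/2})) (Vinf h)"
      unfolding uniqueness_set_def image_image by blast
  }
qed

end
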